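(* The set $\mathbb{G}$ of all quaternionic fractional linear transformations is a group with respect to composition. The map $$\Phi: A=\begin{bmatrix} a & b\\ c & d\end{bmatrix}\mapsto L_A,\qquad L_A(q)=(aq+b)\cdot(cq+d)^{-1},$$ is a group homomorphism of $GL(2,\mathbb{H})$ onto $\mathbb{G}$ whose kernel is the center of $GL(2,\mathbb{H})$, that is, the subgroup $$\left\{\begin{bmatrix} t & 0\\ 0& t\end{bmatrix} : t\in\mathbb{R}\setminus\{0\}\right\}.$$
   Context: $\mathbb{H}$ is the skew field of real quaternions. For a $2\times2$ matrix $A=\begin{bmatrix} a & b\\ c & d\end{bmatrix}$ with entries in $\mathbb{H}$, its (Dieudonné) determinant is the non-negative real number $\det_{\mathbb{H}}(A)=\sqrt{|a|^2|d|^2+|c|^2|b|^2-2\,\mathrm{Re}(c\,\overline{a}\,b\,\overline{d})}$. $GL(2,\mathbb{H})$ is the group (under matrix multiplication) of invertible $2\times 2$ quaternionic matrices, equivalently those with $\det_{\mathbb{H}}(A)\neq0$. A quaternionic fractional linear transformation is a map $L_A(q)=(aq+b)(cq+d)^{-1}$ with $\det_{\mathbb{H}}(A)\ne 0$, regarded as a map of $\mathbb{H}\cup\{\infty\}$ to itself; $\mathbb{G}$ denotes the set of all of them. *)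

theory Defs
  imports "HOL-Analysis.Analysis" "HOL-Algebra.Coset"
begin

codatatype quat = Quat (QRe: real) (QI: real) (QJ: real) (QK: real)

lemma quat_eq_iff: "x = y \<longleftrightarrow> QRe x = QRe y \<and> QI x = QI y \<and> QJ x = QJ y \<and> QK x = QK y"
  by (auto intro: quat.expand)

primcorec qcnj :: "quat \<Rightarrow> quat"
  where
    "QRe (qcnj x) = QRe x"
  | "QI (qcnj x) = - QI x"
  | "QJ (qcnj x) = - QJ x"
  | "QK (qcnj x) = - QK x"

instantiation quat :: ab_group_add
begin

primcorec zero_quat
  where "QRe 0 = 0" | "QI 0 = 0" | "QJ 0 = 0" | "QK 0 = 0"

primcorec plus_quat
  where
    "QRe (x + y) = QRe x + QRe y"
  | "QI (x + y) = QI x + QI y"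
  | "QJ (x + y) = QJ x + QJ y"
  | "QK (x + y) = QK x + QK y"

primcorec uminus_quat
  where
    "QRe (- x) = - QRe x"
  | "QI (- x) = - QI x"
  | "QJ (- x) = - QJ x"
  | "QK (- x) = - QK x"

primcorec minus_quat
  where
    "QRe (x - y) = QRe x - QRe y"
  | "QI (x - y) = QI x - QI y"
  | "QJ (x - y) = QJ x - QJ y"
  | "QK (x - y) = QK x - QK y"

instance
  by standard (simp_all add: quat_eq_iff)

end

text \<open>The product is the bilinear extension of \<open>i\<^sup>2 = j\<^sup>2 = k\<^sup>2 = -1\<close>,
  \<open>ij = -ji = k\<close>, \<open>jk = -kj = i\<close>, \<open>ki = -ik = j\<close>.\<close>

instantiation quat :: ring_1
begin

primcorec one_quat
  where "QRe 1 = 1" | "QI 1 = 0" | "QJ 1 = 0" | "QK 1 = 0"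

primcorec times_quat
  where
    "QRe (x * y) = QRe x * QRe y - QI x * QI y - QJ x * QJ y - QK x * QK y"
  | "QI (x * y) = QRe x * QI y + QI x * QRe y + QJ x * QK y - QK x * QJ y"
  | "QJ (x * y) = QRe x * QJ y - QI x * QK y + QJ x * QRe y + QK x * QI y"
  | "QK (x * y) = QRe x * QK y + QI x * QJ y - QJ x * QI y + QK x * QRe y"

instance
  by standard (simp_all add: quat_eq_iff algebra_simps)

end

instantiation quat :: real_algebra_1
begin

primcorec scaleR_quat
  where
    "QRe (scaleR r x) = r * QRe x"
  | "QI (scaleR r x) = r * QI x"
  | "QJ (scaleR r x) = r * QJ x"
  | "QK (scaleR r x) = r * QK x"

instance
  by standard (simp_all add: quat_eq_iff algebra_simps)

end

instantiation quat :: real_normed_div_algebra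
begin

definition norm_quat :: "quat \<Rightarrow> real"
  where "norm_quat x = sqrt ((QRe x)\<^sup>2 + (QI x)\<^sup>2 + (QJ x)\<^sup>2 + (QK x)\<^sup>2)"

definition inverse_quat :: "quat \<Rightarrow> quat"
  where "inverse_quat x = qcnj x /\<^sub>R (norm x)\<^sup>2"

definition divide_quat :: "quat \<Rightarrow> quat \<Rightarrow> quat"
  where "divide_quat x y = x * inverse y"

definition sgn_quat :: "quat \<Rightarrow> quat"
  where "sgn_quat x = x /\<^sub>R norm x"

definition dist_quat :: "quat \<Rightarrow> quat \<Rightarrow> real"
  where "dist_quat x y = norm (x - y)"

definition uniformity_quat :: "(quat \<times> quat) filter"
  where "uniformity_quat = (INF e\<in>{0 <..}. principal {(x, y). dist x y < e})"

definition open_quat :: "quat set \<Rightarrow> bool"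
  where "open_quat U \<longleftrightarrow> (\<forall>x\<in>U. eventually (\<lambda>(x', y). x' = x \<longrightarrow> y \<in> U) uniformity)"

instance
proof
  fix r :: real and x y :: quat and S :: "quat set"
  have sq: "(norm z)\<^sup>2 = (QRe z)\<^sup>2 + (QI z)\<^sup>2 + (QJ z)\<^sup>2 + (QK z)\<^sup>2" for z :: quat
    by (simp add: norm_quat_def)
  have norm0: "norm z = 0 \<longleftrightarrow> z = 0" for z :: quat
    by (simp add: norm_quat_def quat_eq_iff add_nonneg_eq_0_iff)
  then show "norm x = 0 \<longleftrightarrow> x = 0" .
  have norm_prod: "norm z = norm (Complex (QRe z) (QI z), Complex (QJ z) (QK z))" for z :: quat
    by (simp add: norm_quat_def norm_prod_def cmod_def add.assoc)
  have split: "(Complex (QRe (x + y)) (QI (x + y)), Complex (QJ (x + y)) (QK (x + y))) =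
      (Complex (QRe x) (QI x), Complex (QJ x) (QK x)) + (Complex (QRe y) (QI y), Complex (QJ y) (QK y))"
    by (simp add: complex_eq_iff)
  show "norm (x + y) \<le> norm x + norm y"
    unfolding norm_prod split by (rule norm_triangle_ineq)
  show "norm (scaleR r x) = \<bar>r\<bar> * norm x"
    by (simp add: norm_quat_def power_mult_distrib distrib_left [symmetric] real_sqrt_mult)
  show "norm (x * y) = norm x * norm y"
    unfolding norm_quat_def real_sqrt_mult [symmetric] times_quat.sel
    by (rule arg_cong [where f = sqrt]) algebra
  have cnj: "z * qcnj z = (norm z)\<^sup>2 *\<^sub>R 1" "qcnj z * z = (norm z)\<^sup>2 *\<^sub>R 1" for z
    by (simp_all add: quat_eq_iff sq) (simp_all add: power2_eq_square)
  show "x \<noteq> 0 \<Longrightarrow> inverse x * x = 1" "x \<noteq> 0 \<Longrightarrow> x * inverse x = 1"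
    by (simp_all add: inverse_quat_def cnj norm0)
  show "inverse (0 :: quat) = 0"
    by (simp add: inverse_quat_def quat_eq_iff)
qed (rule divide_quat_def sgn_quat_def dist_quat_def uniformity_quat_def open_quat_def)+

end

definition GL2H :: "(quat^2^2) monoid"
  where "GL2H = \<lparr>carrier = {A. invertible A}, mult = (**), one = mat 1\<rparr>"

definition detH :: "quat^2^2 \<Rightarrow> real"
  where "detH A =
    (let a = A$1$1; b = A$1$2; c = A$2$1; d = A$2$2
     in sqrt ((norm a)\<^sup>2 * (norm d)\<^sup>2 + (norm c)\<^sup>2 * (norm b)\<^sup>2 - 2 * QRe (c * qcnj a * b * qcnj d)))"

definition group_center :: "('a, 'm) monoid_scheme \<Rightarrow> 'a set"
  where "group_center G = {z \<in> carrier G. \<forall>x \<in> carrier G. z \<otimes>\<^bsub>G\<^esub> x = x \<otimes>\<^bsub>G\<^esub> z}"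

datatype hsphere = Fin quat | Infty

text \<open>A vanishing denominator gives \<open>Infty\<close>,
  and \<open>Infty\<close> goes to the limit of \<open>(aq + b)(cq + d)\<^sup>-\<^sup>1\<close> as \<open>|q|\<close> tends to infinity, which
  is \<open>ac\<^sup>-\<^sup>1\<close> if \<open>c\<close> is nonzero and \<open>Infty\<close> otherwise. These conventions are meaningful
  only if \<open>detH A\<close> is nonzero.\<close>

definition lft :: "quat^2^2 \<Rightarrow> hsphere \<Rightarrow> hsphere"
  where "lft A z =
    (let a = A$1$1; b = A$1$2; c = A$2$1; d = A$2$2
     in case z of
          Fin q \<Rightarrow> if c * q + d = 0 then Infty else Fin ((a * q + b) * inverse (c * q + d))
        | Infty \<Rightarrow> if c = 0 then Infty else Fin (a * inverse c))"

definition LFT :: "(hsphere \<Rightarrow> hsphere) monoid"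
  where "LFT = \<lparr>carrier = {lft A | A. detH A \<noteq> 0}, mult = (\<circ>), one = id\<rparr>"

end

theory Submission
  imports Defs
begin

text \<open>The sphere \<open>\<H> \<union> {\<infinity>}\<close> is the quaternionic projective line: a nonzero column \<open>(x, y)\<close> represents
  \<open>x y\<^sup>-\<^sup>1\<close>, or \<open>\<infinity>\<close> when \<open>y = 0\<close>, and columns that differ by a scalar on the right represent the
  same point. Since \<open>(a x y\<^sup>-\<^sup>1 + b)(c x y\<^sup>-\<^sup>1 + d)\<^sup>-\<^sup>1 = (a x + b y)(c x + d y)\<^sup>-\<^sup>1\<close>, the transformation
  \<open>L\<^sub>A\<close> is what multiplication of columns by \<open>A\<close> induces on points (\<open>lft_proj\<close>), and this single formula
  includes all the conventions about \<open>\<infinity>\<close>. Because an invertible \<open>B\<close> sends nonzero columns to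
  nonzero columns, \<open>L\<^sub>A\<^sub>B = L\<^sub>A \<circ> L\<^sub>B\<close> is associativity of the action on columns (\<open>lft_mult\<close>).

  That \<open>\<G>\<close> is the image of \<open>GL(2, \<H>)\<close> means that the determinant vanishes exactly on the
  singular matrices. If \<open>c \<noteq> 0\<close>, the determinant equals \<open>|c| |a c\<^sup>-\<^sup>1 d - b|\<close>. When this number is nonzero
  the matrix has a Bruhat factorisation into invertible factors; when it is zero the matrix kills
  the column \<open>(- c\<^sup>-\<^sup>1 d, 1)\<close>. The case \<open>c = 0\<close> is that of triangular matrices. Hence \<open>\<G>\<close>, as
  the homomorphic image of a group, is a group.

  If \<open>L\<^sub>A\<close> is the identity, its values at \<open>\<infinity>\<close>, \<open>0\<close> and \<open>1\<close> give \<open>c = 0\<close>, \<open>b = 0\<close> and \<open>a = d\<close>, and then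
  \<open>a q a\<^sup>-\<^sup>1 = q\<close> for all \<open>q\<close>, so that \<open>a\<close> is real. If \<open>A\<close> is central, commuting with the two elementary
  transvections and with the scalar matrices gives the same conditions. Thus the kernel and the
  center are both the group of real scalar matrices.\<close>

section \<open>Quaternions\<close>

lemma QRe_mult_commute: "QRe (x * y) = QRe (y * x)"
  by (simp add: algebra_simps)

lemma qcnj_mult: "qcnj (x * y) = qcnj y * qcnj x"
  by (simp add: quat_eq_iff algebra_simps)

lemma norm_quat_power2: "(norm (x::quat))\<^sup>2 = (QRe x)\<^sup>2 + (QI x)\<^sup>2 + (QJ x)\<^sup>2 + (QK x)\<^sup>2"
  by (simp add: norm_quat_def)

lemma qcnj_mult_self: "qcnj x * x = of_real ((norm x)\<^sup>2)"
  by (simp add: quat_eq_iff norm_quat_power2 of_real_def) (simp add: power2_eq_square)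

lemma norm_diff_quat_power2:
  "(norm (x - y))\<^sup>2 = (norm x)\<^sup>2 + (norm y)\<^sup>2 - 2 * QRe (qcnj x * y)" for x y :: quat
  unfolding norm_quat_power2 by (simp add: power2_eq_square algebra_simps)

lemma of_real_commutes: "of_real t * x = x * of_real t" for x :: quat
  by (simp add: of_real_def)

lemma quat_commutes_all_imp_real:
  assumes "\<And>q :: quat. a * q = q * a"
  shows "a = of_real (QRe a)"
proof -
  \<comment> \<open>The units \<open>i\<close> and \<open>j\<close> suffice: commuting with \<open>i\<close> kills the
    \<open>j\<close>- and \<open>k\<close>-parts, commuting with \<open>j\<close> the \<open>i\<close>-part.\<close>
  have "a * Quat 0 1 0 0 = Quat 0 1 0 0 * a" "a * Quat 0 0 1 0 = Quat 0 0 1 0 * a"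
    by (rule assms)+
  then show ?thesis
    by (simp add: quat_eq_iff of_real_def)
qed

section \<open>Two by two matrices\<close>

definition mat2 :: "'a \<Rightarrow> 'a \<Rightarrow> 'a \<Rightarrow> 'a \<Rightarrow> 'a::zero^2^2"
  where "mat2 a b c d = vector [vector [a, b], vector [c, d]]"

lemma mat2_sel [simp]:
  "mat2 a b c d $ 1 $ 1 = a" "mat2 a b c d $ 1 $ 2 = b"
  "mat2 a b c d $ 2 $ 1 = c" "mat2 a b c d $ 2 $ 2 = d"
  by (simp_all add: mat2_def)

lemma mat2_eq_iff: "A = B \<longleftrightarrow>
    A $ 1 $ 1 = B $ 1 $ 1 \<and> A $ 1 $ 2 = B $ 1 $ 2 \<and> A $ 2 $ 1 = B $ 2 $ 1 \<and> A $ 2 $ 2 = B $ 2 $ 2"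
  for A B :: "'a^2^2"
  by (auto simp: vec_eq_iff forall_2)

lemma mat2_cases: obtains a b c d where "A = mat2 a b c d"
  using that [of "A $ 1 $ 1" "A $ 1 $ 2" "A $ 2 $ 1" "A $ 2 $ 2"] by (simp add: mat2_eq_iff)

lemma mat2_inject [simp]:
  "mat2 a b c d = mat2 a' b' c' d' \<longleftrightarrow> a = a' \<and> b = b' \<and> c = c' \<and> d = d'"
  by (simp add: mat2_eq_iff)

lemma mat_eq_mat2: "mat t = mat2 t 0 0 t"
  by (simp add: mat2_eq_iff mat_def)

lemma mat2_mult: "mat2 a b c d ** mat2 a' b' c' d' =
    mat2 (a * a' + b * c') (a * b' + b * d') (c * a' + d * c') (c * b' + d * d')"
  by (simp add: mat2_eq_iff matrix_matrix_mult_def sum_2)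

lemma mat2_mult_vec [simp]:
  "(mat2 a b c d *v v) $ 1 = a * v $ 1 + b * v $ 2"
  "(mat2 a b c d *v v) $ 2 = c * v $ 1 + d * v $ 2"
  by (simp_all add: matrix_vector_mult_def sum_2)

lemma vec2_eq_0_iff: "v = 0 \<longleftrightarrow> v $ 1 = 0 \<and> v $ 2 = 0" for v :: "'a::zero^2"
  by (simp add: vec_eq_iff forall_2)

lemma invertible_matrix_mult:
  fixes A B :: "'a::semiring_1^'n^'n"
  assumes "invertible A" "invertible B"
  shows "invertible (A ** B)"
proof -
  obtain A' B' where "A ** A' = mat 1" "A' ** A = mat 1" "B ** B' = mat 1" "B' ** B = mat 1"
    using assms by (auto simp: invertible_def)
  then have "(A ** B) ** (B' ** A') = mat 1" "(B' ** A') ** (A ** B) = mat 1"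
    by (metis matrix_mul_assoc matrix_mul_rid)+
  then show ?thesis
    by (auto simp: invertible_def)
qed

lemma invertible_mult_vec_eq_0:
  fixes A :: "'a::semiring_1^'n^'n"
  assumes "invertible A" "A *v v = 0"
  shows "v = 0"
  using assms by (metis invertible_def matrix_vector_mul_assoc matrix_vector_mul_lid matrix_vector_mult_0_right)

lemma invertible_mat2_upper:
  fixes a b d :: "'a::division_ring"
  assumes "a \<noteq> 0" "d \<noteq> 0"
  shows "invertible (mat2 a b 0 d)"
  unfolding invertible_def
  by (rule exI [of _ "mat2 (inverse a) (- inverse a * b * inverse d) 0 (inverse d)"])
    (simp add: assms mat2_mult mat_eq_mat2 mult.assoc flip: mult.assoc [of a])

lemma invertible_mat2_antidiagonal:
  fixes b c :: "'a::division_ring"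
  assumes "b \<noteq> 0" "c \<noteq> 0"
  shows "invertible (mat2 0 b c 0)"
  unfolding invertible_def
  by (rule exI [of _ "mat2 0 (inverse c) (inverse b) 0"])
    (simp add: assms mat2_mult mat_eq_mat2)

section \<open>The determinant and invertibility\<close>

text \<open>Writing \<open>d = c w\<close> turns the radicand into \<open>|c|\<^sup>2\<close> times the expansion of \<open>|a w - b|\<^sup>2\<close>, because
  the real part is invariant under cyclic permutation and \<open>c\<close> meets its own conjugate.\<close>

lemma detH_mat2_factor: "detH (mat2 a b c (c * w)) = norm c * norm (a * w - b)"
proof -
  have "QRe (c * qcnj a * b * qcnj (c * w)) = QRe ((c * qcnj a * b * qcnj w) * qcnj c)"
    by (simp only: qcnj_mult mult.assoc)
  also have "\<dots> = QRe ((qcnj c * c) * (qcnj a * b * qcnj w))"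
    by (subst QRe_mult_commute) (simp only: mult.assoc)
  also have "\<dots> = (norm c)\<^sup>2 * QRe ((qcnj a * b) * qcnj w)"
    by (simp add: qcnj_mult_self of_real_def del: times_quat.sel of_real_power)
  also have "\<dots> = (norm c)\<^sup>2 * QRe (qcnj (a * w) * b)"
    by (subst QRe_mult_commute) (simp only: qcnj_mult mult.assoc)
  finally have "(norm a)\<^sup>2 * (norm (c * w))\<^sup>2 + (norm c)\<^sup>2 * (norm b)\<^sup>2
      - 2 * QRe (c * qcnj a * b * qcnj (c * w)) = (norm c * norm (a * w - b))\<^sup>2"
    by (simp add: power_mult_distrib norm_diff_quat_power2 norm_mult algebra_simps del: times_quat.sel)
  then show ?thesis
    by (simp add: detH_def del: times_quat.sel)
qed

lemma detH_mat2_upper: "detH (mat2 a b 0 d) = norm a * norm d"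
  by (simp add: detH_def real_sqrt_mult)

lemma detH_nonzero_imp_invertible:
  assumes "detH A \<noteq> 0"
  shows "invertible A"
proof -
  obtain a b c d where A: "A = mat2 a b c d" by (rule mat2_cases)
  show ?thesis
  proof (cases "c = 0")
    case True
    then show ?thesis
      using assms by (simp add: A detH_mat2_upper invertible_mat2_upper)
  next
    case False
    define w where "w = inverse c * d"
    have d: "d = c * w"
      using False by (simp add: w_def flip: mult.assoc)
    define s where "s = b - a * w"
    have s: "s \<noteq> 0"
      using assms by (auto simp: A d detH_mat2_factor s_def)
    \<comment> \<open>This is the Bruhat decomposition of a matrix in the big cell \<open>c \<noteq> 0\<close>.\<close>
    have "A = mat2 1 (a * inverse c) 0 1 ** mat2 0 s c 0 ** mat2 1 w 0 1"
      using False by (simp add: A d mat2_mult s_def mult.assoc)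
    then show ?thesis
      using False s
      by (simp add: invertible_matrix_mult invertible_mat2_upper invertible_mat2_antidiagonal)
  qed
qed

text \<open>When the determinant vanishes, an explicit nonzero column is annihilated: \<open>(1, 0)\<close>,
  \<open>(- a\<^sup>-\<^sup>1 b, 1)\<close> or \<open>(- c\<^sup>-\<^sup>1 d, 1)\<close>.\<close>

lemma invertible_imp_detH_nonzero:
  assumes "invertible A"
  shows "detH A \<noteq> 0"
proof
  assume 0: "detH A = 0"
  obtain a b c d where A: "A = mat2 a b c d" by (rule mat2_cases)
  have kernel_trivial: "x = 0 \<and> y = 0" if "a * x + b * y = 0" "c * x + d * y = 0" for x y
    using invertible_mult_vec_eq_0 [OF assms, of "vector [x, y]"] that
    by (simp add: A vec2_eq_0_iff)
  show False
  proof (cases "c = 0")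
    case True
    then have "a = 0 \<or> d = 0"
      using 0 by (simp add: A detH_mat2_upper)
    then show False
    proof (cases "a = 0")
      case True
      then show False
        using kernel_trivial [of 1 0] \<open>c = 0\<close> by simp
    next
      case False
      then show False
        using kernel_trivial [of "- inverse a * b" 1] \<open>c = 0\<close> \<open>a = 0 \<or> d = 0\<close>
        by (simp flip: mult.assoc)
    qed
  next
    case False
    define w where "w = inverse c * d"
    have d: "d = c * w"
      using False by (simp add: w_def flip: mult.assoc)
    have "a * w = b"
      using 0 False by (simp add: A d detH_mat2_factor)
    then show False
      using kernel_trivial [of "- w" 1] by (simp add: d)
  qed
qed

lemma invertible_iff_detH_nonzero: "invertible A \<longleftrightarrow> detH A \<noteq> 0"
  using detH_nonzero_imp_invertible invertible_imp_detH_nonzero by blast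

section \<open>Fractional linear transformations in homogeneous coordinates\<close>

text \<open>The value at the zero column is a dummy; only nonzero columns represent points.\<close>

definition proj :: "quat^2 \<Rightarrow> hsphere"
  where "proj v = (if v $ 2 = 0 then Infty else Fin (v $ 1 * inverse (v $ 2)))"

lemma proj_surj: obtains v where "v \<noteq> 0" "z = proj v"
proof (cases z)
  case (Fin q)
  then show ?thesis
    using that [of "vector [q, 1]"] by (simp add: proj_def vec2_eq_0_iff)
next
  case Infty
  then show ?thesis
    using that [of "vector [1, 0]"] by (simp add: proj_def vec2_eq_0_iff)
qed

text \<open>A common right factor of numerator and denominator cancels, so \<open>x y\<^sup>-\<^sup>1\<close> may be replaced by
  the column \<open>(x, y)\<close>.\<close>

lemma lft_proj:
  assumes "v \<noteq> 0"
  shows "lft A (proj v) = proj (A *v v)"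
proof -
  obtain a b c d where A: "A = mat2 a b c d" by (rule mat2_cases)
  obtain x y where v: "v $ 1 = x" "v $ 2 = y" by blast
  show ?thesis
  proof (cases "y = 0")
    case True
    then have "x \<noteq> 0"
      using assms v by (simp add: vec2_eq_0_iff)
    then have "a * x * inverse (c * x) = a * inverse c" if "c \<noteq> 0"
      using that by (simp add: nonzero_inverse_mult_distrib mult.assoc flip: mult.assoc [of x])
    then show ?thesis
      using \<open>x \<noteq> 0\<close> True by (simp add: lft_def proj_def A v)
  next
    case False
    have factor: "p * (x * inverse y) + r = (p * x + r * y) * inverse y" for p r
      using False by (simp add: distrib_right mult.assoc)
    have cancel: "(n * inverse y) * inverse (m * inverse y) = n * inverse m" if "m \<noteq> 0" for n m
      using that False
      by (simp add: nonzero_inverse_mult_distrib mult.assoc flip: mult.assoc [of "inverse y"])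
    show ?thesis
      using False by (simp add: lft_def proj_def A v factor cancel)
  qed
qed

text \<open>Invertibility of \<open>B\<close> keeps \<open>B v\<close> nonzero, so that \<open>lft_proj\<close> applies to it a second time.\<close>

lemma lft_mult:
  assumes "invertible B"
  shows "lft (A ** B) = lft A \<circ> lft B"
proof
  fix z
  obtain v where v: "v \<noteq> 0" "z = proj v" by (rule proj_surj)
  moreover have "B *v v \<noteq> 0"
    using assms v(1) invertible_mult_vec_eq_0 by blast
  ultimately show "lft (A ** B) z = (lft A \<circ> lft B) z"
    by (simp add: lft_proj matrix_vector_mul_assoc)
qed

lemma lft_mat_of_real:
  assumes "t \<noteq> 0"
  shows "lft (mat (of_real t)) = id"
proof
  fix z
  have "of_real t * q * inverse (of_real t) = q" for q :: quat
    using assms by (simp add: of_real_commutes mult.assoc)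
  then show "lft (mat (of_real t)) z = id z"
    using assms by (cases z) (simp_all add: lft_def mat_eq_mat2)
qed

lemma lft_eq_id_imp_real_scalar:
  assumes "invertible A" "lft A = id"
  obtains t :: real where "t \<noteq> 0" "A = mat (of_real t)"
proof -
  obtain a b c d where A: "A = mat2 a b c d" by (rule mat2_cases)
  have L: "lft (mat2 a b c d) z = z" for z
    using assms(2) by (simp add: A)
  have c: "c = 0"
    using L [of Infty] by (simp add: lft_def split: if_splits)
  have d: "d \<noteq> 0"
    using L [of "Fin 0"] by (simp add: lft_def c split: if_splits)
  have b: "b = 0"
    using L [of "Fin 0"] d by (simp add: lft_def c)
  have conj: "a * q * inverse d = q" for q
    using L [of "Fin q"] d by (simp add: lft_def b c)
  have comm: "a * q = q * d" for q
  proof -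
    have "a * q = (a * q * inverse d) * d"
      using d by (simp add: mult.assoc)
    then show ?thesis by (simp add: conj)
  qed
  have "a = d"
    using comm [of 1] by simp
  then have "a = of_real (QRe a)"
    using comm by (intro quat_commutes_all_imp_real) simp
  then show thesis
    using that [of "QRe a"] d \<open>a = d\<close> by (metis A b c mat_eq_mat2 of_real_0)
qed

section \<open>The groups\<close>

lemma group_GL2H: "group GL2H"
proof (rule groupI)
  fix A assume "A \<in> carrier GL2H"
  then show "\<exists>B\<in>carrier GL2H. B \<otimes>\<^bsub>GL2H\<^esub> A = \<one>\<^bsub>GL2H\<^esub>"
    by (auto simp: GL2H_def invertible_def)
qed (auto simp: GL2H_def invertible_matrix_mult matrix_mul_assoc invertible_def [of "mat 1"])

lemma lft_image_carrier: "lft ` carrier GL2H = carrier LFT"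
  by (auto simp: GL2H_def LFT_def invertible_iff_detH_nonzero)

lemma lft_hom: "lft \<in> hom GL2H LFT"
  using lft_image_carrier by (auto simp: hom_def GL2H_def LFT_def lft_mult)

lemma lft_one: "lft (mat 1) = id"
  using lft_mat_of_real [of 1] by simp

lemma group_LFT: "group LFT"
proof -
  have "group (LFT \<lparr>carrier := lft ` carrier GL2H, one := lft \<one>\<^bsub>GL2H\<^esub>\<rparr>)"
    by (rule group.hom_imp_img_group [OF group_GL2H lft_hom])
  moreover have "LFT \<lparr>carrier := lft ` carrier GL2H, one := lft \<one>\<^bsub>GL2H\<^esub>\<rparr> = LFT"
    unfolding lft_image_carrier by (simp add: LFT_def GL2H_def lft_one)
  ultimately show ?thesis by simp
qed

lemma invertible_mat_of_real:
  assumes "t \<noteq> 0"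
  shows "invertible (mat (of_real t) :: quat^2^2)"
  using assms by (simp add: mat_eq_mat2 invertible_mat2_upper)

lemma kernel_lft: "kernel GL2H LFT lft = {mat (of_real t) | t :: real. t \<noteq> 0}"
  by (auto simp: kernel_def GL2H_def LFT_def invertible_mat_of_real lft_mat_of_real
      elim: lft_eq_id_imp_real_scalar)

lemma central_imp_real_scalar:
  fixes A :: "quat^2^2"
  assumes "invertible A" and central: "\<And>B. invertible B \<Longrightarrow> A ** B = B ** A"
  obtains t :: real where "t \<noteq> 0" "A = mat (of_real t)"
proof -
  obtain a b c d where A: "A = mat2 a b c d" by (rule mat2_cases)
  have c: "c = 0" and ad: "a = d"
    using central [of "mat2 1 1 0 1"] by (simp_all add: A mat2_mult invertible_mat2_upper)
  have "detH (mat2 1 0 1 1) \<noteq> 0"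
    using detH_mat2_factor [of 1 0 1 1] by simp
  then have b: "b = 0"
    using central [of "mat2 1 0 1 1"] by (simp add: A mat2_mult invertible_iff_detH_nonzero)
  have "a * q = q * a" for q
    using central [of "mat q"]
    by (cases "q = 0") (simp_all add: A b c mat2_mult mat_eq_mat2 invertible_mat2_upper)
  then have a: "a = of_real (QRe a)"
    by (rule quat_commutes_all_imp_real)
  have "a \<noteq> 0"
    using invertible_imp_detH_nonzero [OF assms(1)] by (simp add: A c detH_mat2_upper)
  then show thesis
    using that [of "QRe a"] a by (metis A ad b c mat_eq_mat2 of_real_0)
qed

lemma mat_of_real_commutes: "mat (of_real t) ** A = A ** mat (of_real t)" for A :: "quat^2^2"
  by (rule mat2_cases [of A]) (simp add: mat_eq_mat2 mat2_mult of_real_commutes)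

lemma center_GL2H: "group_center GL2H = {mat (of_real t) | t :: real. t \<noteq> 0}"
  by (auto simp: group_center_def GL2H_def invertible_mat_of_real mat_of_real_commutes
      elim: central_imp_real_scalar)

theorem theorem1p2:
  shows "group LFT
    \<and> group_hom GL2H LFT lft
    \<and> lft ` carrier GL2H = carrier LFT
    \<and> kernel GL2H LFT lft = group_center GL2H
    \<and> group_center GL2H = {mat (of_real t) | t :: real. t \<noteq> 0}
    \<and> subgroup {mat (of_real t) | t :: real. t \<noteq> 0} GL2H"
proof -
  have hom: "group_hom GL2H LFT lft"
    by (simp add: group_hom_def group_hom_axioms_def group_GL2H group_LFT lft_hom)
  show ?thesis
    using group_hom.subgroup_kernel [OF hom]
    by (simp add: group_LFT hom lft_image_carrier kernel_lft center_GL2H)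
qed

end
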